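(* The set $\overline{\mathsf{R}}\subseteq\mathbb{Z}[i]^{\mathbb{N}}$, regarded as a subshift with the left shift map $\sigma$, has the right feeble specification property.
   Context: For $z\in\mathbb{C}$, $[z]:=\lfloor \mathrm{Re}(z)+\tfrac12\rfloor+i\lfloor \mathrm{Im}(z)+\tfrac12\rfloor$; $\mathfrak{F}:=\{z: -\tfrac12\le \mathrm{Re}(z)<\tfrac12,\ -\tfrac12\le \mathrm{Im}(z)<\tfrac12\}$; $T(0)=0$ and $T(z)=z^{-1}-[z^{-1}]$ for $z\in\mathfrak{F}\setminus\{0\}$; $a_1(z)=[z^{-1}]$, $a_n(z)=a_1(T^{n-1}(z))$ when $T^{n-1}(z)\neq0$. Cylinders $\mathcal{C}_n(b_1,\dots,b_n):=\{z\in\mathfrak{F}: a_j(z)=b_j,\ 1\le j\le n\}$, with interior $\mathcal{C}^{\circ}_n(b_1,\dots,b_n)$. $\overline{\mathsf{R}}:=\{(a_n)\in\mathbb{Z}[i]^{\mathbb{N}}:\forall n,\ \mathcal{C}^{\circ}_n(a_1,\dots,a_n)\ne\emptyset\}$, with the product topology (discrete topology on $\mathbb{Z}[i]$), and $\sigma((x_n)_{n\ge1})=(x_{n+1})_{n\ge1}$. For a subshift $X$ over an alphabet $\mathcal{A}$, $\mathcal{L}(X)$ denotes the set of finite words occurring as factors of elements of $X$; $|\mathbf{u}|$ is the length of a finite word; $\mathbf{u}\mathbf{v}$ is concatenation; for words $\mathbf{v}=(v_1,\dots,v_n)$, $\mathbf{w}=(w_1,\dots,w_n)$ of equal length, $d_H(\mathbf{v},\mathbf{w})=\#\{j: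 v_j\ne w_j\}/n$. $X$ has the right feeble specification property if there is $\mathcal{G}\subseteq\mathcal{L}(X)$ such that (i) $\mathbf{u},\mathbf{v}\in\mathcal{G}$ implies $\mathbf{u}\mathbf{v}\in\mathcal{G}$; (ii) for every $\varepsilon>0$ there is $N\in\mathbb{N}$ such that for every $\mathbf{u}\in\mathcal{G}$ and every $\mathbf{v}\in\mathcal{L}(X)$ with $|\mathbf{v}|\ge N$ there exist finite words $\mathbf{s},\mathbf{v}'$ over $\mathcal{A}$ (with $\mathbf{s}$ possibly empty) with $|\mathbf{v}'|=|\mathbf{v}|$, $0\le|\mathbf{s}|\le\varepsilon|\mathbf{v}|$, $d_H(\mathbf{v},\mathbf{v}')<\varepsilon$ and $\mathbf{u}\mathbf{s}\mathbf{v}'\in\mathcal{G}$. *)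

theory Defs
  imports "HOL-Analysis.Analysis"
begin

subsection \<open>Words and subshifts\<close>

text \<open>One-sided sequences \<open>(x\<^sub>n)\<close> with \<open>n \<ge> 1\<close> are functions on \<^typ>\<open>nat\<close>, the value at \<open>n\<close> being
  \<open>x\<^sub>n\<^sub>+\<^sub>1\<close>. Finite words are lists. The alphabet is a set \<open>A\<close>, not a whole type.\<close>

definition shift :: "(nat \<Rightarrow> 'a) \<Rightarrow> nat \<Rightarrow> 'a" where
  "shift x = (\<lambda>n. x (Suc n))"

definition subshift :: "'a set \<Rightarrow> (nat \<Rightarrow> 'a) set \<Rightarrow> bool" where
  "subshift A X \<longleftrightarrow>
     closedin (product_topology (\<lambda>_. discrete_topology A) UNIV) X \<and> shift ` X \<subseteq> X"

definition language :: "(nat \<Rightarrow> 'a) set \<Rightarrow> 'a list set" where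
  "language X = {map x [i..<i + n] | x i n. x \<in> X}"

text \<open>Only meant for words of equal length.\<close>

definition hamming_dist :: "'a list \<Rightarrow> 'a list \<Rightarrow> real" where
  "hamming_dist v w = real (card {j. j < length v \<and> v ! j \<noteq> w ! j}) / real (length v)"

text \<open>Without \<open>G \<noteq> {}\<close> every \<open>X\<close> would have the property, with the empty set as \<open>G\<close>.\<close>

definition right_feeble_specification :: "'a set \<Rightarrow> (nat \<Rightarrow> 'a) set \<Rightarrow> bool" where
  "right_feeble_specification A X \<longleftrightarrow>
     (\<exists>G \<subseteq> language X. G \<noteq> {} \<and>
        (\<forall>u\<in>G. \<forall>v\<in>G. u @ v \<in> G) \<and>
        (\<forall>\<epsilon>::real. \<epsilon> > 0 \<longrightarrow>
           (\<exists>N::nat. \<forall>u\<in>G. \<forall>v\<in>language X. length v \<ge> N \<longrightarrow>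
              (\<exists>s\<in>lists A. \<exists>v'\<in>lists A.
                 length v' = length v \<and>
                 real (length s) \<le> \<epsilon> * real (length v) \<and>
                 hamming_dist v v' < \<epsilon> \<and>
                 u @ s @ v' \<in> G))))"


subsection \<open>Hurwitz continued fractions\<close>

definition gauss_ints :: "complex set" where
  "gauss_ints = {z. Re z \<in> \<int> \<and> Im z \<in> \<int>}"

definition nearest_gauss :: "complex \<Rightarrow> complex" where
  "nearest_gauss z =
     of_int \<lfloor>Re z + 1/2\<rfloor> + \<i> * of_int \<lfloor>Im z + 1/2\<rfloor>"

definition hurwitz_domain :: "complex set" where
  "hurwitz_domain = {z. -1/2 \<le> Re z \<and> Re z < 1/2 \<and> -1/2 \<le> Im z \<and> Im z < 1/2}"

definition hurwitz_map :: "complex \<Rightarrow> complex" where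
  "hurwitz_map z = (if z = 0 then 0 else inverse z - nearest_gauss (inverse z))"

text \<open>\<open>hurwitz_digit n z\<close> is the partial quotient \<open>a\<^sub>n\<^sub>+\<^sub>1(z)\<close>; it is \<^term>\<open>None\<close> once the expansion
  has terminated, so that cylinders contain only points all of whose relevant digits exist.\<close>

definition hurwitz_digit :: "nat \<Rightarrow> complex \<Rightarrow> complex option" where
  "hurwitz_digit n z =
     (let w = (hurwitz_map ^^ n) z
      in if w = 0 then None else Some (nearest_gauss (inverse w)))"

definition cylinder :: "complex list \<Rightarrow> complex set" where
  "cylinder bs =
     {z \<in> hurwitz_domain. \<forall>j < length bs. hurwitz_digit j z = Some (bs ! j)}"

definition Rbar :: "(nat \<Rightarrow> complex) set" where
  "Rbar = {a. (\<forall>n. a n \<in> gauss_ints) \<and>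
              (\<forall>n\<ge>1. interior (cylinder (map a [0..<n])) \<noteq> {})}"

end

theory Submission
  imports Defs
begin

text \<open>Take as \<open>G\<close> the full words \<open>w\<close>, those for which \<open>T\<^sup>n\<close> maps the cylinder of \<open>w\<close>, \<open>n = |w|\<close>, onto
  the whole square up to its boundary; they are closed under concatenation. For an arbitrary word
  whose cylinder has interior, the image of the cylinder is, up to boundary, the square minus some
  of the unit discs around \<open>p\<close>, \<open>q i\<close> and \<open>p + q i\<close>, for suitable \<open>p, q\<close> in \<open>{1, -1}\<close>. Near the origin
  this leaves a whole quadrant, so the letter \<open>-3p + 3q i\<close> may follow and makes the word full. Hence
  changing only the last letter of any word of the language yields a full word, and \<open>s\<close> can be empty.\<close>

section \<open>Images of cylinders and full words\<close>

definition follower_step :: "complex set \<Rightarrow> complex \<Rightarrow> complex set" where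
  "follower_step E b = {f \<in> hurwitz_domain. b + f \<noteq> 0 \<and> inverse (b + f) \<in> E}"

text \<open>For a word \<open>w\<close> of \<open>n\<close> Gaussian integers this is the image of
  its cylinder under the \<open>n\<close>-th iterate of T, built letter by letter: a point
  \<open>z\<close> of the square has first digit \<open>b\<close> and T-image \<open>f\<close>
  exactly when \<open>z = inverse (b + f)\<close> with \<open>f\<close> in the square.\<close>

definition followers :: "complex list \<Rightarrow> complex set" where
  "followers w = foldl follower_step hurwitz_domain w"

definition full_words :: "complex list set" where
  "full_words = {w \<in> lists gauss_ints. interior hurwitz_domain \<subseteq> followers w}"

lemma followers_Nil [simp]: "followers [] = hurwitz_domain"
  by (simp add: followers_def)

lemma followers_snoc [simp]: "followers (w @ [b]) = follower_step (followers w) b"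
  by (simp add: followers_def)

lemma followers_append: "followers (u @ v) = foldl follower_step (followers u) v"
  by (simp add: followers_def)

lemma interior_hurwitz_domain:
  "interior hurwitz_domain = {z. \<bar>Re z\<bar> < 1/2 \<and> \<bar>Im z\<bar> < 1/2}"
proof -
  have eq: "hurwitz_domain = {z. -1/2 \<le> Re z} \<inter> {z. Re z < 1/2} \<inter> {z. -1/2 \<le> Im z} \<inter> {z. Im z < 1/2}"
    by (auto simp: hurwitz_domain_def)
  have re: "{z. -1/2 \<le> Re z} = {z. 1 \<bullet> z \<ge> -1/2}"
    and im: "{z. -1/2 \<le> Im z} = {z. \<i> \<bullet> z \<ge> -1/2}"
    by (auto simp: inner_complex_def)
  have re': "interior {z. -1/2 \<le> Re z} = {z. -1/2 < Re z}"
    unfolding re by (subst interior_halfspace_ge) (auto simp: inner_complex_def)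
  have im': "interior {z. -1/2 \<le> Im z} = {z. -1/2 < Im z}"
    unfolding im by (subst interior_halfspace_ge) (auto simp: inner_complex_def)
  show ?thesis
    unfolding eq interior_Int re' im' interior_open[OF open_halfspace_Re_lt]
      interior_open[OF open_halfspace_Im_lt]
    by auto
qed

subsection \<open>Cylinders and their followers\<close>

lemma gauss_intsE:
  assumes "b \<in> gauss_ints"
  obtains x y :: int where "Re b = of_int x" "Im b = of_int y"
  using assms by (auto simp: gauss_ints_def elim!: Ints_cases)

text \<open>The half-open square is a fundamental domain for translation by Gaussian
  integers.\<close>

lemma nearest_gauss_eq_iff:
  assumes "b \<in> gauss_ints"
  shows "nearest_gauss w = b \<longleftrightarrow> w - b \<in> hurwitz_domain"
proof -
  obtain m n where "Re b = of_int m" "Im b = of_int n"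
    using assms by (rule gauss_intsE)
  then show ?thesis
    by (auto simp: nearest_gauss_def hurwitz_domain_def complex_eq_iff floor_eq_iff)
qed

text \<open>Once the first digit is known to be \<open>b\<close>, T acts as
  \<open>inverse z - b\<close>, so the later digits of \<open>z\<close> are the digits of that point
  moved by one place.\<close>

lemma cylinder_Cons:
  assumes "b \<in> gauss_ints"
  shows "cylinder (b # bs) = {z \<in> hurwitz_domain. z \<noteq> 0 \<and> inverse z - b \<in> cylinder bs}"
proof -
  have 0: "hurwitz_digit 0 z = Some b \<longleftrightarrow> z \<noteq> 0 \<and> inverse z - b \<in> hurwitz_domain" for z
    using nearest_gauss_eq_iff[OF assms] by (auto simp: hurwitz_digit_def Let_def)
  have S: "hurwitz_digit (Suc j) z = hurwitz_digit j (inverse z - b)"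
    if "z \<noteq> 0" "inverse z - b \<in> hurwitz_domain" for z j
  proof -
    have "hurwitz_map z = inverse z - b"
      using that nearest_gauss_eq_iff[OF assms] by (simp add: hurwitz_map_def)
    then show ?thesis by (simp add: hurwitz_digit_def funpow_Suc_right del: funpow.simps)
  qed
  show ?thesis
    by (auto simp: cylinder_def All_less_Suc2 0 S)
qed

lemma open_inverse_vimage:
  fixes U :: "complex set"
  assumes "open U"
  shows "open {f. b + f \<noteq> 0 \<and> inverse (b + f) \<in> U}"
    and "open {z. z \<noteq> 0 \<and> inverse z - b \<in> U}"
proof -
  have o: "open {f. b + f \<noteq> 0}" "open {z::complex. z \<noteq> 0}"
    by (intro open_Collect_neq continuous_intros)+
  have "open ({f. b + f \<noteq> 0} \<inter> (\<lambda>f. inverse (b + f)) -` U)"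
    by (rule continuous_open_preimage[OF _ o(1) assms]) (auto intro!: continuous_on_inverse continuous_on_add continuous_on_diff)
  then show "open {f. b + f \<noteq> 0 \<and> inverse (b + f) \<in> U}"
    by (simp add: vimage_def Int_def)
  have "open ({z. z \<noteq> 0} \<inter> (\<lambda>z. inverse z - b) -` U)"
    by (rule continuous_open_preimage[OF _ o(2) assms]) (auto intro!: continuous_on_inverse continuous_on_add continuous_on_diff)
  then show "open {z. z \<noteq> 0 \<and> inverse z - b \<in> U}"
    by (simp add: vimage_def Int_def)
qed

lemma interior_nonempty_iff: "interior A \<noteq> {} \<longleftrightarrow> (\<exists>U. open U \<and> U \<noteq> {} \<and> U \<subseteq> A)"
  by (metis interior_maximal interior_subset open_interior subset_empty)

lemma follower_step_subset: "follower_step E b \<subseteq> hurwitz_domain"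
  by (auto simp: follower_step_def)

text \<open>The maps \<open>inverse z - b\<close> and \<open>inverse (b + f)\<close> are mutually
  inverse and continuous where defined, and they match the two sets \<open>?A\<close> and
  \<open>?B\<close>, so an open set in one gives an open set in the other. The set \<open>X\<close>
  is arbitrary because the induction replaces it by \<open>follower_step X b\<close>.\<close>

lemma interior_cylinder_Int:
  assumes "set bs \<subseteq> gauss_ints" "X \<subseteq> hurwitz_domain"
  shows "interior (X \<inter> cylinder bs) \<noteq> {} \<longleftrightarrow> interior (foldl follower_step X bs) \<noteq> {}"
  using assms
proof (induction bs arbitrary: X)
  case Nil
  then show ?case by (simp add: cylinder_def Int_absorb2)
next
  case (Cons b bs)
  let ?A = "X \<inter> cylinder (b # bs)" and ?B = "follower_step X b \<inter> cylinder bs"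
  have A: "?A = {z. z \<noteq> 0 \<and> z \<in> X \<and> inverse z - b \<in> cylinder bs}"
    using Cons.prems by (auto simp: cylinder_Cons)
  have B: "?B = {f. b + f \<noteq> 0 \<and> inverse (b + f) \<in> X \<and> f \<in> cylinder bs}"
    by (auto simp: follower_step_def cylinder_def)
  have "interior ?A \<noteq> {} \<longleftrightarrow> interior ?B \<noteq> {}"
  proof
    assume "interior ?A \<noteq> {}"
    then obtain U z where U: "open U" "z \<in> U" "U \<subseteq> ?A"
      unfolding interior_nonempty_iff by blast
    let ?V = "{f. b + f \<noteq> 0 \<and> inverse (b + f) \<in> U}"
    have "?V \<subseteq> ?B" using U(3) unfolding A B by fastforce
    moreover have "inverse z - b \<in> ?V" using U unfolding A by auto
    ultimately show "interior ?B \<noteq> {}"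
      using open_inverse_vimage(1)[OF U(1), of b] unfolding interior_nonempty_iff by blast
  next
    assume "interior ?B \<noteq> {}"
    then obtain U f where U: "open U" "f \<in> U" "U \<subseteq> ?B"
      unfolding interior_nonempty_iff by blast
    let ?V = "{z. z \<noteq> 0 \<and> inverse z - b \<in> U}"
    have "?V \<subseteq> ?A" using U(3) unfolding A B by fastforce
    moreover have "inverse (b + f) \<in> ?V" using U unfolding B by auto
    ultimately show "interior ?A \<noteq> {}"
      using open_inverse_vimage(2)[OF U(1), of b] unfolding interior_nonempty_iff by blast
  qed
  also have "\<dots> \<longleftrightarrow> interior (foldl follower_step (follower_step X b) bs) \<noteq> {}"
    using Cons.IH[OF _ follower_step_subset] Cons.prems by simp
  finally show ?case by simp
qed

lemma interior_cylinder_iff: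
  assumes "set bs \<subseteq> gauss_ints"
  shows "interior (cylinder bs) \<noteq> {} \<longleftrightarrow> interior (followers bs) \<noteq> {}"
proof -
  have "hurwitz_domain \<inter> cylinder bs = cylinder bs"
    by (auto simp: cylinder_def)
  then show ?thesis
    using interior_cylinder_Int[OF assms, of hurwitz_domain] by (simp add: followers_def)
qed

lemma foldl_follower_step_mono:
  "E \<subseteq> E' \<Longrightarrow> foldl follower_step E v \<subseteq> foldl follower_step E' v"
proof (induction v arbitrary: E E')
  case (Cons b v)
  have "follower_step E b \<subseteq> follower_step E' b"
    using Cons.prems by (auto simp: follower_step_def)
  then show ?case using Cons.IH by simp
qed simp

text \<open>An open set of followers pulls back through every letter to an open subset of
  \<open>E\<close>, hence to a subset of \<open>interior E\<close>. This is what allows boundary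
  points to be ignored throughout.\<close>

lemma foldl_follower_step_interior:
  assumes "open U" "U \<subseteq> foldl follower_step E v"
  shows "U \<subseteq> foldl follower_step (interior E) v"
  using assms
proof (induction v arbitrary: U rule: rev_induct)
  case Nil
  then show ?case by (simp add: interior_maximal)
next
  case (snoc b v)
  let ?V = "{z. z \<noteq> 0 \<and> inverse z - b \<in> U}"
  have U: "U \<subseteq> follower_step (foldl follower_step E v) b"
    using snoc.prems by simp
  then have "?V \<subseteq> foldl follower_step E v"
    by (force simp: follower_step_def)
  then have "?V \<subseteq> foldl follower_step (interior E) v"
    using snoc.IH open_inverse_vimage(2)[OF snoc.prems(1)] by blast
  then have "inverse (b + f) \<in> foldl follower_step (interior E) v" if "f \<in> U" for f
    using U that by (force simp: follower_step_def)
  then show ?case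
    using U follower_step_def[of _ b] by auto
qed

lemma interior_followers_prefix:
  assumes "interior (followers (u @ v)) \<noteq> {}"
  shows "interior (followers u) \<noteq> {}"
proof
  assume e: "interior (followers u) = {}"
  have "interior (followers (u @ v)) \<subseteq> foldl follower_step (interior (followers u)) v"
    by (rule foldl_follower_step_interior) (auto simp: followers_append interior_subset)
  moreover have "foldl follower_step {} v = {}"
    by (induction v) (auto simp: follower_step_def)
  ultimately show False using e assms by simp
qed

lemma followers_subset: "followers u \<subseteq> hurwitz_domain"
  by (cases u rule: rev_cases) (auto simp: follower_step_def)

text \<open>Reading \<open>u\<close> first only shrinks the set from which \<open>v\<close>
  starts.\<close>

lemma interior_followers_suffix:
  assumes "interior (followers (u @ v)) \<noteq> {}"
  shows "interior (followers v) \<noteq> {}"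
proof -
  have "followers (u @ v) \<subseteq> followers v"
    unfolding followers_append followers_def[of v]
    by (rule foldl_follower_step_mono) (rule followers_subset)
  then show ?thesis using assms interior_mono by blast
qed

text \<open>After \<open>u\<close> only the open square is guaranteed, but since \<open>v\<close>
  covers an open set, it does so starting from the open square alone.\<close>

lemma full_words_append:
  assumes "u \<in> full_words" "v \<in> full_words"
  shows "u @ v \<in> full_words"
proof -
  have "interior hurwitz_domain \<subseteq> foldl follower_step (interior hurwitz_domain) v"
    using assms(2) by (intro foldl_follower_step_interior) (auto simp: full_words_def followers_def)
  also have "\<dots> \<subseteq> followers (u @ v)"
    using assms(1) unfolding followers_append
    by (intro foldl_follower_step_mono) (simp add: full_words_def)
  finally show ?thesis using assms by (simp add: full_words_def)
qed

subsection \<open>The shape of follower sets\<close>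

definition open_region :: "(int \<times> int) set \<Rightarrow> complex set" where
  "open_region S = {z. \<bar>Re z\<bar> < 1/2 \<and> \<bar>Im z\<bar> < 1/2 \<and>
     (\<forall>(m, n)\<in>S. (Re z - of_int m)\<^sup>2 + (Im z - of_int n)\<^sup>2 > 1)}"

definition closed_region :: "(int \<times> int) set \<Rightarrow> complex set" where
  "closed_region S = {z. \<bar>Re z\<bar> \<le> 1/2 \<and> \<bar>Im z\<bar> \<le> 1/2 \<and>
     (\<forall>(m, n)\<in>S. (Re z - of_int m)\<^sup>2 + (Im z - of_int n)\<^sup>2 \<ge> 1)}"

definition quadrant_centres :: "int \<Rightarrow> int \<Rightarrow> (int \<times> int) set" where
  "quadrant_centres p q = {(p, 0), (0, q), (p, q)}"

text \<open>Squeezing \<open>E\<close> between an open and a closed region leaves undecided which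
  boundary arcs belong to \<open>E\<close>; only interiors matter.\<close>

definition quadrantal :: "complex set \<Rightarrow> bool" where
  "quadrantal E \<longleftrightarrow> (\<exists>p\<in>{1, -1}. \<exists>q\<in>{1, -1}. \<exists>S\<subseteq>quadrant_centres p q.
     open_region S \<subseteq> E \<and> E \<subseteq> closed_region S)"

section \<open>Inversion of the square and of unit discs\<close>

text \<open>With \<open>c = m + n i\<close> this is |1 - c w|^2 - |w|^2, expanded. If |c| = 1 the
  quadratic term vanishes and a half-plane Re(c w) < 1/2 remains; if |c|^2 = 2 the condition becomes
  a distance above 1 from the conjugate of \<open>c\<close>.\<close>

lemma inverse_dist_centre:
  fixes m n :: real
  assumes "w \<noteq> 0"
  shows "((Re (inverse w) - m)\<^sup>2 + (Im (inverse w) - n)\<^sup>2 - 1) * ((Re w)\<^sup>2 + (Im w)\<^sup>2)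
    = 1 - 2 * (m * Re w - n * Im w) + (m\<^sup>2 + n\<^sup>2 - 1) * ((Re w)\<^sup>2 + (Im w)\<^sup>2)"
proof -
  define x y r where "x = Re w" and "y = Im w" and "r = x\<^sup>2 + y\<^sup>2"
  have r: "r \<noteq> 0" using assms by (auto simp: r_def x_def y_def complex_eq_iff)
  have "((x / r - m)\<^sup>2 + (- y / r - n)\<^sup>2 - 1) * r = 1 - 2 * (m * x - n * y) + (m\<^sup>2 + n\<^sup>2 - 1) * r"
  proof -
    have "((x / r - m)\<^sup>2 + (- y / r - n)\<^sup>2 - 1) * r
      = (x\<^sup>2 + y\<^sup>2) / r - 2 * (m * x - n * y) + (m\<^sup>2 + n\<^sup>2 - 1) * r"
      using r by (simp add: field_simps power2_eq_square)
    then show ?thesis using r by (simp add: r_def[symmetric])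
  qed
  then show ?thesis by (simp add: x_def y_def r_def)
qed

lemma norm_square_pos: "w \<noteq> 0 \<Longrightarrow> (Re w)\<^sup>2 + (Im w)\<^sup>2 > 0"
  by (simp add: complex_neq_0)

lemma inverse_dist_centre_iff:
  assumes "w \<noteq> 0"
  shows "(Re (inverse w) - m)\<^sup>2 + (Im (inverse w) - n)\<^sup>2 > 1 \<longleftrightarrow>
      1 - 2 * (m * Re w - n * Im w) + (m\<^sup>2 + n\<^sup>2 - 1) * ((Re w)\<^sup>2 + (Im w)\<^sup>2) > 0"
    and "(Re (inverse w) - m)\<^sup>2 + (Im (inverse w) - n)\<^sup>2 \<ge> 1 \<longleftrightarrow>
      1 - 2 * (m * Re w - n * Im w) + (m\<^sup>2 + n\<^sup>2 - 1) * ((Re w)\<^sup>2 + (Im w)\<^sup>2) \<ge> 0"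
  unfolding inverse_dist_centre[OF assms, symmetric]
  using norm_square_pos[OF assms] by (auto simp: zero_less_mult_iff zero_le_mult_iff)

text \<open>The inequalities on the right say that \<open>w\<close> lies outside the unit discs
  around 1, -1, i and -i, the inverted form of the four sides of the square.\<close>

lemma inverse_square_iff:
  assumes "w \<noteq> 0"
  shows "\<bar>Re (inverse w)\<bar> < 1/2 \<and> \<bar>Im (inverse w)\<bar> < 1/2 \<longleftrightarrow>
      2 * \<bar>Re w\<bar> < (Re w)\<^sup>2 + (Im w)\<^sup>2 \<and> 2 * \<bar>Im w\<bar> < (Re w)\<^sup>2 + (Im w)\<^sup>2"
    and "\<bar>Re (inverse w)\<bar> \<le> 1/2 \<and> \<bar>Im (inverse w)\<bar> \<le> 1/2 \<longleftrightarrow>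
      2 * \<bar>Re w\<bar> \<le> (Re w)\<^sup>2 + (Im w)\<^sup>2 \<and> 2 * \<bar>Im w\<bar> \<le> (Re w)\<^sup>2 + (Im w)\<^sup>2"
proof -
  define r where "r = (Re w)\<^sup>2 + (Im w)\<^sup>2"
  have r: "r > 0" using norm_square_pos[OF assms] by (simp add: r_def)
  have "\<bar>Re (inverse w)\<bar> = \<bar>Re w\<bar> / r" "\<bar>Im (inverse w)\<bar> = \<bar>Im w\<bar> / r"
    using r by (simp_all add: r_def abs_divide)
  then show "\<bar>Re (inverse w)\<bar> < 1/2 \<and> \<bar>Im (inverse w)\<bar> < 1/2 \<longleftrightarrow>
      2 * \<bar>Re w\<bar> < (Re w)\<^sup>2 + (Im w)\<^sup>2 \<and> 2 * \<bar>Im w\<bar> < (Re w)\<^sup>2 + (Im w)\<^sup>2"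
    and "\<bar>Re (inverse w)\<bar> \<le> 1/2 \<and> \<bar>Im (inverse w)\<bar> \<le> 1/2 \<longleftrightarrow>
      2 * \<bar>Re w\<bar> \<le> (Re w)\<^sup>2 + (Im w)\<^sup>2 \<and> 2 * \<bar>Im w\<bar> \<le> (Re w)\<^sup>2 + (Im w)\<^sup>2"
    unfolding r_def[symmetric] using r by (simp_all only:) (simp_all add: field_simps)
qed

definition unit_centres :: "(int \<times> int) set" where
  "unit_centres = {(1, 0), (-1, 0), (0, 1), (0, -1)}"

text \<open>Inversion maps the disc around a unit to a half-plane bounded by a line through half-integers,
  which no translate of the square by a Gaussian integer meets only in part, and the disc around
  a point of norm 2 to the disc around its conjugate.\<close>

definition inverted_centres :: "(int \<times> int) set \<Rightarrow> (int \<times> int) set" where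
  "inverted_centres S = unit_centres \<union> {(m, - n) | m n. (m, n) \<in> S \<and> m \<noteq> 0 \<and> n \<noteq> 0}"

lemma mem_quadrant_centres_cases:
  assumes "(m, n) \<in> quadrant_centres p q" "p \<in> {1, -1}" "q \<in> {1, -1}"
  shows "(m = 0 \<or> n = 0) \<and> (of_int m)\<^sup>2 + (of_int n)\<^sup>2 = (1::real) \<or>
    m \<noteq> 0 \<and> n \<noteq> 0 \<and> (of_int m)\<^sup>2 = (1::real) \<and> (of_int n)\<^sup>2 = (1::real)"
  using assms by (auto simp: quadrant_centres_def)

text \<open>The units in \<open>inverted_centres S\<close> account for the square, the other
  inverted centres for the removed discs with centre of norm 2, and \<open>half\<close> for the
  removed discs around units.\<close>

lemma inverse_in_open_region:
  assumes w: "w \<noteq> 0" and S: "S \<subseteq> quadrant_centres p q" "p \<in> {1, -1}" "q \<in> {1, -1}"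
    and far: "\<And>m n. (m, n) \<in> inverted_centres S \<Longrightarrow> (Re w - of_int m)\<^sup>2 + (Im w - of_int n)\<^sup>2 > 1"
    and half: "\<And>m n. (m, n) \<in> S \<Longrightarrow> m = 0 \<or> n = 0 \<Longrightarrow> of_int m * Re w - of_int n * Im w < 1/2"
  shows "inverse w \<in> open_region S"
proof -
  have "\<bar>Re (inverse w)\<bar> < 1/2 \<and> \<bar>Im (inverse w)\<bar> < 1/2"
    unfolding inverse_square_iff[OF w]
    using far[of 1 0] far[of "-1" 0] far[of 0 1] far[of 0 "-1"]
    by (auto simp: inverted_centres_def unit_centres_def power2_eq_square algebra_simps abs_if)
  moreover have "(Re (inverse w) - of_int m)\<^sup>2 + (Im (inverse w) - of_int n)\<^sup>2 > 1"
    if mn: "(m, n) \<in> S" for m n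
  proof -
    have "(m, n) \<in> quadrant_centres p q" using mn S by blast
    from mem_quadrant_centres_cases[OF this S(2,3)] show ?thesis
    proof (elim disjE conjE)
      assume *: "m \<noteq> 0" "n \<noteq> 0" "(of_int m)\<^sup>2 = (1::real)" "(of_int n)\<^sup>2 = (1::real)"
      have "(m, - n) \<in> inverted_centres S" using * mn by (auto simp: inverted_centres_def)
      from far[OF this] show ?thesis
        unfolding inverse_dist_centre_iff[OF w] using * by (simp add: power2_sum power2_diff algebra_simps)
    next
      assume "(of_int m)\<^sup>2 + (of_int n)\<^sup>2 = (1::real)" "m = 0"
      then show ?thesis unfolding inverse_dist_centre_iff[OF w] using half[OF mn] by simp
    next
      assume "(of_int m)\<^sup>2 + (of_int n)\<^sup>2 = (1::real)" "n = 0"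
      then show ?thesis unfolding inverse_dist_centre_iff[OF w] using half[OF mn] by simp
    qed
  qed
  ultimately show ?thesis by (auto simp: open_region_def)
qed

text \<open>The non-strict converse. It bounds follower sets from above and, applied to a single
  point, restricts the possible letters.\<close>

lemma inverse_in_closed_regionD:
  assumes w: "w \<noteq> 0" and S: "S \<subseteq> quadrant_centres p q" "p \<in> {1, -1}" "q \<in> {1, -1}"
    and z: "inverse w \<in> closed_region S"
  shows "(m, n) \<in> inverted_centres S \<Longrightarrow> (Re w - of_int m)\<^sup>2 + (Im w - of_int n)\<^sup>2 \<ge> 1"
    and "(m, n) \<in> S \<Longrightarrow> m = 0 \<or> n = 0 \<Longrightarrow> of_int m * Re w - of_int n * Im w \<le> 1/2"
proof -
  have sq: "2 * \<bar>Re w\<bar> \<le> (Re w)\<^sup>2 + (Im w)\<^sup>2" "2 * \<bar>Im w\<bar> \<le> (Re w)\<^sup>2 + (Im w)\<^sup>2"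
    using z inverse_square_iff(2)[OF w] unfolding closed_region_def by blast+
  have far: "(Re (inverse w) - of_int m)\<^sup>2 + (Im (inverse w) - of_int n)\<^sup>2 \<ge> 1" if "(m, n) \<in> S" for m n
    using z that unfolding closed_region_def by blast
  show "(Re w - of_int m)\<^sup>2 + (Im w - of_int n)\<^sup>2 \<ge> 1" if mn: "(m, n) \<in> inverted_centres S"
  proof (cases "(m, n) \<in> unit_centres")
    case True
    then show ?thesis
      using sq by (auto simp: unit_centres_def power2_eq_square algebra_simps)
  next
    case False
    then have mn: "(m, - n) \<in> S" "m \<noteq> 0" "n \<noteq> 0"
      using mn by (auto simp: inverted_centres_def)
    then have "(m, - n) \<in> quadrant_centres p q" using S by blast
    from mem_quadrant_centres_cases[OF this S(2,3)] mn
    have "(of_int m)\<^sup>2 = (1::real)" "(of_int n)\<^sup>2 = (1::real)" by auto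
    then show ?thesis
      using far[OF mn(1)] unfolding inverse_dist_centre_iff[OF w]
      by (simp add: power2_sum power2_diff algebra_simps)
  qed
  show "of_int m * Re w - of_int n * Im w \<le> 1/2" if mn: "(m, n) \<in> S" "m = 0 \<or> n = 0"
  proof -
    have "(m, n) \<in> quadrant_centres p q" using mn S by blast
    from mem_quadrant_centres_cases[OF this S(2,3)] mn(2)
    have "(of_int m)\<^sup>2 + (of_int n)\<^sup>2 = (1::real)" by auto
    then show ?thesis
      using far[OF mn(1)] unfolding inverse_dist_centre_iff[OF w] by simp
  qed
qed

section \<open>Adding one letter\<close>

text \<open>All inverted centres have coordinates in {-1, 0, 1}, so seen from a letter with
  \<open>x > 0\<close> the nearby ones lie at horizontal offset 0 or -1, and similarly for the other
  signs and for \<open>y\<close>.\<close>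

lemma translated_centres_quadrant:
  fixes x y p q :: int
  assumes pq: "p \<in> {1, -1}" "q \<in> {1, -1}" and S: "S \<subseteq> quadrant_centres p q"
    and b: "(x, y) \<noteq> (0, 0)" "(x, y) \<notin> inverted_centres S"
  obtains p' q' where "p' \<in> {1, -1}" "q' \<in> {1, -1}"
    "{(m - x, n - y) | m n. (m, n) \<in> inverted_centres S \<and> \<bar>m - x\<bar> \<le> 1 \<and> \<bar>n - y\<bar> \<le> 1}
       \<subseteq> quadrant_centres p' q'"
proof -
  \<comment> \<open>If \<open>x = 0\<close>, then \<bar>y\<bar> is at least 2, because the letter is
    neither 0 nor a unit. A nearby centre off the vertical axis can then only be
    \<open>(p, - q)\<close>, which fixes the sign. The case \<open>y = 0\<close> is symmetric and
    yields \<open>- q\<close>.\<close>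
  define p' where "p' = (if x > 0 then -1 else if x < 0 then 1 else p)"
  define q' where "q' = (if y > 0 then -1 else if y < 0 then 1 else - q)"
  have p': "p' \<in> {1, -1}" and q': "q' \<in> {1, -1}"
    using pq by (auto simp: p'_def q'_def)
  have u: "(x, y) \<notin> unit_centres" using b(2) by (simp add: inverted_centres_def)
  have "(m - x, n - y) \<in> quadrant_centres p' q'"
    if mn: "(m, n) \<in> inverted_centres S" and nb: "\<bar>m - x\<bar> \<le> 1" "\<bar>n - y\<bar> \<le> 1" for m n
  proof -
    have ne: "(m, n) \<noteq> (x, y)" using mn b(2) by auto
    have "(m, n) \<in> unit_centres \<or> m = p \<and> n = - q"
      using mn S pq by (auto simp: inverted_centres_def quadrant_centres_def)
    then have "(m - x = 0 \<or> m - x = p') \<and> (n - y = 0 \<or> n - y = q')"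
      using nb u b(1) pq unfolding unit_centres_def p'_def q'_def insert_iff empty_iff prod.inject
      by (smt (verit))
    then show ?thesis using ne by (auto simp: quadrant_centres_def)
  qed
  then have "{(m - x, n - y) | m n. (m, n) \<in> inverted_centres S \<and> \<bar>m - x\<bar> \<le> 1 \<and> \<bar>n - y\<bar> \<le> 1}
       \<subseteq> quadrant_centres p' q'" by blast
  then show thesis using that p' q' by blast
qed

lemma power2_gt_1: "\<bar>t::real\<bar> > 1 \<Longrightarrow> t\<^sup>2 > 1"
  by (metis abs_square_le_1 not_le)

lemma quadrantal_follower_step:
  assumes E: "quadrantal E" and b: "b \<in> gauss_ints"
    and ne: "interior (follower_step E b) \<noteq> {}"
  shows "quadrantal (follower_step E b)"
proof -
  obtain p q S where pq: "p \<in> {1, -1}" "q \<in> {1, -1}" and S: "S \<subseteq> quadrant_centres p q"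
    and lo: "open_region S \<subseteq> E" and hi: "E \<subseteq> closed_region S"
    using E unfolding quadrantal_def by blast
  obtain x y where xy: "Re b = of_int x" "Im b = of_int y" using b by (rule gauss_intsE)
  \<comment> \<open>One interior point decides everything about the letter: it lies strictly inside
    the square, so the inequalities it satisfies become sharp statements about integers.\<close>
  obtain f where f: "f \<in> interior (follower_step E b)" using ne by blast
  have fE: "b + f \<noteq> 0" "inverse (b + f) \<in> closed_region S"
    using f interior_subset hi by (fastforce simp: follower_step_def)+
  have fF: "\<bar>Re f\<bar> < 1/2" "\<bar>Im f\<bar> < 1/2"
    using f interior_mono[OF follower_step_subset] interior_hurwitz_domain by blast+
  note f_hi = inverse_in_closed_regionD[OF fE(1) S pq fE(2)]
  have f1: "(Re f)\<^sup>2 + (Im f)\<^sup>2 < 1"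
  proof -
    have "(Re f)\<^sup>2 \<le> (1/2)\<^sup>2" "(Im f)\<^sup>2 \<le> (1/2)\<^sup>2"
      using fF by (auto intro!: power2_le_iff_abs_le[THEN iffD2])
    then show ?thesis by (simp add: power2_eq_square)
  qed
  have not_centre: "(x, y) \<notin> inverted_centres S"
    using f_hi(1)[of x y] f1 by (auto simp: xy)
  \<comment> \<open>For the letter 0 the inverse of \<open>f\<close> would have to lie in the closed
    square together with \<open>f\<close>, which is impossible since inversion sends the punctured
    open square outside it.\<close>
  have not_0: "(x, y) \<noteq> (0, 0)"
  proof
    assume "(x, y) = (0, 0)"
    then have bf: "b + f = f" by (simp add: xy complex_eq_iff)
    have "2 * \<bar>Re (b + f)\<bar> \<le> (Re (b + f))\<^sup>2 + (Im (b + f))\<^sup>2"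
      "2 * \<bar>Im (b + f)\<bar> \<le> (Re (b + f))\<^sup>2 + (Im (b + f))\<^sup>2"
      using fE inverse_square_iff(2)[OF fE(1)] unfolding closed_region_def by blast+
    then have "2 * \<bar>Re f\<bar> \<le> (Re f)\<^sup>2 + (Im f)\<^sup>2" "2 * \<bar>Im f\<bar> \<le> (Re f)\<^sup>2 + (Im f)\<^sup>2"
      unfolding bf by blast+
    moreover have "(Re f)\<^sup>2 \<le> \<bar>Re f\<bar> / 2" "(Im f)\<^sup>2 \<le> \<bar>Im f\<bar> / 2"
      using fF mult_left_mono[of "\<bar>Re f\<bar>" "1/2" "\<bar>Re f\<bar>"] mult_left_mono[of "\<bar>Im f\<bar>" "1/2" "\<bar>Im f\<bar>"]
      by (auto simp: power2_eq_square)
    moreover have "(Re f)\<^sup>2 + (Im f)\<^sup>2 > 0"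
      using fE(1) norm_square_pos unfolding bf by blast
    ultimately show False by linarith
  qed
  \<comment> \<open>Centres two or more units away from \<open>b\<close> in some coordinate have
    distance above 3/2 from every point of the translated open square, so they remove
    nothing.\<close>
  define S' where "S' = {(m - x, n - y) | m n. (m, n) \<in> inverted_centres S \<and> \<bar>m - x\<bar> \<le> 1 \<and> \<bar>n - y\<bar> \<le> 1}"
  obtain p' q' where pq': "p' \<in> {1, -1}" "q' \<in> {1, -1}" and S': "S' \<subseteq> quadrant_centres p' q'"
    using translated_centres_quadrant[OF pq S not_0 not_centre] unfolding S'_def by blast
  \<comment> \<open>The point \<open>f\<close> gives a value below 1/2 + 1/2, and the left side is
    an integer. Hence the whole translated open square lies in the half-plane and no new line cuts
    it.\<close>
  have half: "m * x - n * y \<le> 0" if "(m, n) \<in> S" "m = 0 \<or> n = 0" for m n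
  proof -
    have "m \<in> {0, 1, -1}" "n \<in> {0, 1, -1}"
      using that S pq by (auto simp: quadrant_centres_def)
    then have "of_int (m * x - n * y) < (1::real)"
      using f_hi(2)[OF that] that(2) fF by (auto simp: xy)
    then show ?thesis by linarith
  qed
  have "open_region S' \<subseteq> follower_step E b"
  proof
    fix z assume z: "z \<in> open_region S'"
    then have zF: "\<bar>Re z\<bar> < 1/2" "\<bar>Im z\<bar> < 1/2" by (auto simp: open_region_def)
    have "b + z \<noteq> 0"
    proof
      assume "b + z = 0"
      then have "\<bar>of_int x :: real\<bar> < 1" "\<bar>of_int y :: real\<bar> < 1"
        using zF by (auto simp: complex_eq_iff xy)
      then have "\<bar>x\<bar> < 1" "\<bar>y\<bar> < 1" by linarith+
      then show False using not_0 by simp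
    qed
    moreover have "inverse (b + z) \<in> open_region S"
    proof (rule inverse_in_open_region[OF calculation S pq])
      fix m n assume mn: "(m, n) \<in> inverted_centres S"
      show "(Re (b + z) - of_int m)\<^sup>2 + (Im (b + z) - of_int n)\<^sup>2 > 1"
      proof (cases "\<bar>m - x\<bar> \<le> 1 \<and> \<bar>n - y\<bar> \<le> 1")
        case True
        then have "(m - x, n - y) \<in> S'" using mn by (auto simp: S'_def)
        then have "(Re z - of_int (m - x))\<^sup>2 + (Im z - of_int (n - y))\<^sup>2 > 1"
          using z unfolding open_region_def by blast
        then show ?thesis by (simp add: xy algebra_simps)
      next
        case False
        then have "\<bar>of_int (m - x) :: real\<bar> \<ge> 2 \<or> \<bar>of_int (n - y) :: real\<bar> \<ge> 2"
          by linarith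
        then have "\<bar>Re (b + z) - of_int m\<bar> > 1 \<or> \<bar>Im (b + z) - of_int n\<bar> > 1"
          using zF by (simp add: xy) linarith
        then have "(Re (b + z) - of_int m)\<^sup>2 > 1 \<or> (Im (b + z) - of_int n)\<^sup>2 > 1"
          using power2_gt_1 by blast
        then show ?thesis
          by (smt (verit) zero_le_power2)
      qed
    next
      fix m n assume mn: "(m, n) \<in> S" "m = 0 \<or> n = 0"
      then have "m \<in> {0, 1, -1}" "n \<in> {0, 1, -1}"
        using S pq by (auto simp: quadrant_centres_def)
      moreover have "of_int (m * x - n * y) \<le> (0::real)"
        using half[OF mn] by linarith
      ultimately show "of_int m * Re (b + z) - of_int n * Im (b + z) < 1/2"
        using mn(2) zF by (auto simp: xy)
    qed
    ultimately show "z \<in> follower_step E b"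
      using lo zF by (auto simp: follower_step_def hurwitz_domain_def)
  qed
  moreover have "follower_step E b \<subseteq> closed_region S'"
  proof
    fix z assume z: "z \<in> follower_step E b"
    then have zE: "b + z \<noteq> 0" "inverse (b + z) \<in> closed_region S"
      using hi by (auto simp: follower_step_def)
    have "(Re z - of_int (m - x))\<^sup>2 + (Im z - of_int (n - y))\<^sup>2 \<ge> 1"
      if "(m, n) \<in> inverted_centres S" for m n
      using inverse_in_closed_regionD(1)[OF zE(1) S pq zE(2) that]
      by (simp add: xy algebra_simps)
    moreover have "\<bar>Re z\<bar> \<le> 1/2" "\<bar>Im z\<bar> \<le> 1/2"
      using z by (auto simp: follower_step_def hurwitz_domain_def)
    ultimately show "z \<in> closed_region S'"
      by (auto simp: closed_region_def S'_def)
  qed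
  ultimately show ?thesis
    using pq' S' unfolding quadrantal_def by blast
qed

lemma quadrantal_imp_full_letter:
  assumes "quadrantal E"
  obtains g where "g \<in> gauss_ints" "interior hurwitz_domain \<subseteq> follower_step E g"
proof -
  obtain p q S where pq: "p \<in> {1, -1}" "q \<in> {1, -1}" and S: "S \<subseteq> quadrant_centres p q"
    and lo: "open_region S \<subseteq> E"
    using assms unfolding quadrantal_def by blast
  \<comment> \<open>The inverse of this letter is -(p + q i)/6, pointing away from all removed
    discs. The factor 3 keeps \<bar>Re (g + f)\<bar> above 5/2, hence more than 1 away from the real
    part of every inverted centre.\<close>
  define g where "g = Complex (of_int (- 3 * p)) (of_int (3 * q))"
  have "f \<in> follower_step E g" if "f \<in> interior hurwitz_domain" for f
  proof -
    have f: "\<bar>Re f\<bar> < 1/2" "\<bar>Im f\<bar> < 1/2" using that by (auto simp: interior_hurwitz_domain)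
    have nz: "g + f \<noteq> 0"
      using f pq by (auto simp: g_def complex_eq_iff)
    have "inverse (g + f) \<in> open_region S"
    proof (rule inverse_in_open_region[OF nz S pq])
      fix m n assume "(m, n) \<in> inverted_centres S"
      then have "m \<in> {-1, 0, 1}"
        using S pq by (auto simp: inverted_centres_def unit_centres_def quadrant_centres_def)
      then have "\<bar>Re (g + f) - of_int m\<bar> > 1"
        using f pq by (auto simp: g_def)
      then have "(Re (g + f) - of_int m)\<^sup>2 > 1" by (rule power2_gt_1)
      then show "(Re (g + f) - of_int m)\<^sup>2 + (Im (g + f) - of_int n)\<^sup>2 > 1"
        by (smt (verit) zero_le_power2)
    next
      fix m n assume "(m, n) \<in> S" "m = 0 \<or> n = 0"
      then have "(m, n) = (p, 0) \<or> (m, n) = (0, q)"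
        using S pq by (auto simp: quadrant_centres_def)
      then show "of_int m * Re (g + f) - of_int n * Im (g + f) < 1/2"
        using f pq by (auto simp: g_def)
    qed
    then show ?thesis
      using lo nz that interior_subset by (auto simp: follower_step_def)
  qed
  moreover have "g \<in> gauss_ints" by (simp add: g_def gauss_ints_def)
  ultimately show thesis using that by blast
qed

lemma quadrantal_followers:
  assumes "set w \<subseteq> gauss_ints" "interior (followers w) \<noteq> {}"
  shows "quadrantal (followers w)"
  using assms
proof (induction w rule: rev_induct)
  case Nil
  have "open_region {} \<subseteq> hurwitz_domain" "hurwitz_domain \<subseteq> closed_region {}"
    by (auto simp: open_region_def closed_region_def hurwitz_domain_def)
  then show ?case
    unfolding quadrantal_def followers_Nil by blast
next
  case (snoc b w)
  then show ?case
    using quadrantal_follower_step[of "followers w" b] interior_followers_prefix[of w "[b]"] by simp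
qed

lemma ex_full_extension:
  assumes "set w \<subseteq> gauss_ints" "interior (followers w) \<noteq> {}"
  obtains g where "w @ [g] \<in> full_words"
proof -
  obtain g where "g \<in> gauss_ints" "interior hurwitz_domain \<subseteq> follower_step (followers w) g"
    using quadrantal_imp_full_letter[OF quadrantal_followers[OF assms]] .
  then show thesis
    using assms(1) that[of g] by (auto simp: full_words_def)
qed

subsection \<open>The shift space\<close>

lemma interior_hurwitz_domain_nonempty: "interior hurwitz_domain \<noteq> {}"
proof -
  have "0 \<in> interior hurwitz_domain" by (simp add: interior_hurwitz_domain)
  then show ?thesis by blast
qed

text \<open>Turns the cylinder condition into one on follower sets. The index \<open>n = 0\<close>,
  absent from the definition, is harmless because the square has interior.\<close>

lemma Rbar_iff:
  "a \<in> Rbar \<longleftrightarrow> range a \<subseteq> gauss_ints \<and> (\<forall>n. interior (followers (map a [0..<n])) \<noteq> {})"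
proof (cases "range a \<subseteq> gauss_ints")
  case True
  then have "interior (cylinder (map a [0..<n])) \<noteq> {} \<longleftrightarrow> interior (followers (map a [0..<n])) \<noteq> {}" for n
    by (intro interior_cylinder_iff) auto
  moreover have "interior (followers (map a [0..<0])) \<noteq> {}"
    by (simp add: interior_hurwitz_domain_nonempty)
  ultimately have "(\<forall>n\<ge>1. interior (cylinder (map a [0..<n])) \<noteq> {}) \<longleftrightarrow>
      (\<forall>n. interior (followers (map a [0..<n])) \<noteq> {})"
    by (metis One_nat_def Suc_leI neq0_conv)
  then show ?thesis using True by (auto simp: Rbar_def)
qed (auto simp: Rbar_def)

text \<open>A factor is a suffix of a prefix, and passing to suffixes preserves nonempty
  interior.\<close>

lemma language_Rbar:
  assumes "v \<in> language Rbar"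
  shows "set v \<subseteq> gauss_ints" "interior (followers v) \<noteq> {}"
proof -
  obtain x i n where x: "x \<in> Rbar" and v: "v = map x [i..<i + n]"
    using assms by (auto simp: language_def)
  show "set v \<subseteq> gauss_ints" using x v by (auto simp: Rbar_iff)
  have "map x [0..<i + n] = map x [0..<i] @ v"
    unfolding v by (subst upt_add_eq_append) simp_all
  then show "interior (followers v) \<noteq> {}"
    using x interior_followers_suffix unfolding Rbar_iff by metis
qed

lemma subshift_Rbar: "subshift gauss_ints Rbar"
proof -
  let ?T = "product_topology (\<lambda>_::nat. discrete_topology gauss_ints) UNIV"
  have "shift a \<in> Rbar" if "a \<in> Rbar" for a
  proof -
    have "map a [0..<Suc n] = [a 0] @ map (shift a) [0..<n]" for n
      by (rule nth_equalityI) (auto simp: shift_def nth_Cons simp del: upt_Suc split: nat.split)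
    then have "interior (followers (map (shift a) [0..<n])) \<noteq> {}" for n
      using that interior_followers_suffix unfolding Rbar_iff by metis
    then show ?thesis
      using that by (auto simp: Rbar_iff shift_def)
  qed
  moreover have "closedin ?T Rbar"
  proof -
    have "openin ?T (topspace ?T - Rbar)"
    proof (subst openin_subopen, intro ballI)
      fix a assume a: "a \<in> topspace ?T - Rbar"
      then have ra: "range a \<subseteq> gauss_ints" by (auto simp: PiE_iff)
      then obtain n where n: "interior (followers (map a [0..<n])) = {}"
        using a by (auto simp: Rbar_iff)
      \<comment> \<open>Failure at length \<open>n\<close> depends on the first \<open>n\<close>
        letters only, so it persists on this basic open neighbourhood.\<close>
      let ?U = "Pi\<^sub>E UNIV (\<lambda>i. if i < n then {a i} else gauss_ints)"
      have "openin ?T ?U"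
        using ra by (subst openin_PiE_gen) (auto intro: finite_subset[of _ "{..<n}"])
      moreover have "a \<in> ?U" using ra by auto
      moreover have "?U \<subseteq> topspace ?T - Rbar"
      proof
        fix c assume c: "c \<in> ?U"
        have "c i = a i" if "i < n" for i
          using c that by (auto simp: PiE_iff split: if_splits)
        then have "map c [0..<n] = map a [0..<n]" by simp
        then have "c \<notin> Rbar" using n unfolding Rbar_iff by metis
        moreover have "c i \<in> gauss_ints" for i
          using c ra by (auto simp: PiE_iff split: if_splits)
        ultimately show "c \<in> topspace ?T - Rbar" by (auto simp: PiE_iff)
      qed
      ultimately show "\<exists>U. openin ?T U \<and> a \<in> U \<and> U \<subseteq> topspace ?T - Rbar" by blast
    qed
    moreover have "Rbar \<subseteq> topspace ?T" by (auto simp: Rbar_def)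
    ultimately show ?thesis by (simp add: closedin_def)
  qed
  ultimately show ?thesis by (auto simp: subshift_def)
qed

lemma Nil_in_full_words: "[] \<in> full_words"
  by (simp add: full_words_def interior_subset)

lemma full_words_subset_language: "full_words \<subseteq> language Rbar"
proof
  fix w assume w: "w \<in> full_words"
  obtain g where g: "[g] \<in> full_words"
    using ex_full_extension[of "[]"] interior_hurwitz_domain_nonempty by auto
  \<comment> \<open>Repeating a full letter forever continues \<open>w\<close> so that every prefix
    of the sequence is a prefix of some full word, hence has followers with interior.\<close>
  define a where "a = (\<lambda>n. if n < length w then w ! n else g)"
  have full: "w @ replicate k g \<in> full_words" for k
  proof (induction k)
    case (Suc k)
    then show ?case
      using full_words_append[OF Suc g] by (simp add: replicate_append_same)
  qed (simp add: w)
  have a: "map a [0..<length w + k] = w @ replicate k g" for k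
    by (rule nth_equalityI) (auto simp: a_def nth_append)
  have "interior (followers (map a [0..<n])) \<noteq> {}" for n
  proof -
    have "map a [0..<length w + n] = map a [0..<n] @ map a [n..<n + length w]"
      by (simp add: upt_add_eq_append[of 0 n "length w"] add.commute)
    moreover have "interior (followers (map a [0..<length w + n])) \<noteq> {}"
    proof -
      have "interior hurwitz_domain \<subseteq> interior (followers (w @ replicate n g))"
        using full[of n] by (intro interior_maximal) (auto simp: full_words_def)
      then show ?thesis unfolding a using interior_hurwitz_domain_nonempty by blast
    qed
    ultimately show ?thesis using interior_followers_prefix by metis
  qed
  moreover have "range a \<subseteq> gauss_ints"
    using w g by (auto simp: a_def full_words_def)
  ultimately have "a \<in> Rbar" by (simp add: Rbar_iff)
  moreover have "w = map a [0..<0 + length w]" using a[of 0] by simp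
  ultimately show "w \<in> language Rbar" unfolding language_def by blast
qed

lemma right_feeble_specification_Rbar: "right_feeble_specification gauss_ints Rbar"
proof -
  have "\<exists>N. \<forall>u\<in>full_words. \<forall>v\<in>language Rbar. length v \<ge> N \<longrightarrow>
      (\<exists>s\<in>lists gauss_ints. \<exists>v'\<in>lists gauss_ints. length v' = length v \<and>
        real (length s) \<le> \<epsilon> * real (length v) \<and> hamming_dist v v' < \<epsilon> \<and> u @ s @ v' \<in> full_words)"
    if \<epsilon>: "\<epsilon> > 0" for \<epsilon> :: real
  proof -
    \<comment> \<open>One changed letter costs \<open>1 / length v\<close>. Positivity of
      \<open>N\<close> also ensures that \<open>v\<close> has a last letter to change.\<close>
    obtain N where N: "1 / \<epsilon> < real N" using reals_Archimedean2 by blast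
    have "N > 0" using N \<epsilon> by (cases N) auto
    show ?thesis
    proof (intro exI[of _ N] ballI impI)
      fix u v assume u: "u \<in> full_words" and v: "v \<in> language Rbar" and len: "N \<le> length v"
      obtain v0 c where vc: "v = v0 @ [c]"
        using len \<open>N > 0\<close> by (cases v rule: rev_cases) auto
      have "set v0 \<subseteq> gauss_ints" "interior (followers v0) \<noteq> {}"
        using language_Rbar[OF v] interior_followers_prefix[of v0 "[c]"] unfolding vc by simp_all
      then obtain g where g: "v0 @ [g] \<in> full_words"
        by (rule ex_full_extension)
      \<comment> \<open>Only an inclusion, since the full letter \<open>g\<close> may happen to
        equal \<open>c\<close>.\<close>
      have "{j. j < length v \<and> v ! j \<noteq> (v0 @ [g]) ! j} \<subseteq> {length v0}"
        by (auto simp: vc nth_append)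
      then have "card {j. j < length v \<and> v ! j \<noteq> (v0 @ [g]) ! j} \<le> 1"
        using card_mono[of "{length v0}"] by simp
      then have "hamming_dist v (v0 @ [g]) \<le> 1 / real (length v)"
        unfolding hamming_dist_def by (intro divide_right_mono) auto
      also have "\<dots> \<le> 1 / real N"
        using len \<open>N > 0\<close> by (simp add: frac_le)
      also have "\<dots> < \<epsilon>"
        using N \<epsilon> \<open>N > 0\<close> by (simp add: field_simps)
      finally have "hamming_dist v (v0 @ [g]) < \<epsilon>" .
      moreover have "v0 @ [g] \<in> lists gauss_ints" using g by (simp add: full_words_def)
      ultimately show "\<exists>s\<in>lists gauss_ints. \<exists>v'\<in>lists gauss_ints. length v' = length v \<and>
          real (length s) \<le> \<epsilon> * real (length v) \<and> hamming_dist v v' < \<epsilon> \<and> u @ s @ v' \<in> full_words"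
        using full_words_append[OF u g] \<epsilon>
        by (intro bexI[of _ "[]"] bexI[of _ "v0 @ [g]"]) (auto simp: vc)
    qed
  qed
  then show ?thesis
    unfolding right_feeble_specification_def
    using full_words_subset_language full_words_append Nil_in_full_words
    by (intro exI[of _ full_words]) auto
qed

theorem theorem1p3:
  "subshift gauss_ints Rbar \<and> right_feeble_specification gauss_ints Rbar"
  using subshift_Rbar right_feeble_specification_Rbar by blast

end
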